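(* Let $X_0\xrightarrow{\varphi}X_1\xleftarrow{\pi}Y\times X_0$ be a similarity scheme, with associated spaces $X_n$, maps $\varphi_{n,m}:X_m\to X_n$, and limit space $X_\infty=Y^{\mathbb N}/\mathcal R_\infty$. Then there exist maps $\varphi_{\infty,n}:X_n\to X_\infty$ such that (a) $\varphi_{\infty,n}\circ\varphi_{n,m}=\varphi_{\infty,m}$; (b) $\bigcup_{n}\varphi_{\infty,n}(X_n)$ is dense in $X_\infty$.
   Context: Similarity scheme. A similarity scheme $X_0\xrightarrow{\varphi}X_1\xleftarrow{\pi}Y\times X_0$ consists of compact Hausdorff spaces $X_0,X_1,Y$, a continuous injective map $\varphi:X_0\to X_1$ and a continuous surjective map $\pi:Y\times X_0\to X_1$. Tower. Put $\varphi_{1,0}=\varphi$, $\pi_{1,0}=\pi$. Inductively, for $n\ge1$, let $X_{n+1}=(Y\times X_n)/\sim$ (quotient topology), where $(y,z)\sim(y',z')$ iff either $(y,z)=(y',z')$ or there are $x_0,x_0'\in X_0$ with $z=\varphi_{n,0}(x_0)$, $z'=\varphi_{n,0}(x_0')$, $\pi(y,x_0)=\pi(y',x_0')$; let $\pi_{1,n}:Y\times X_n\to X_{n+1}$ be the quotient map, and let $\varphi_{n+1,n}:X_n\to X_{n+1}$ be the (well-defined, continuous, injective) map with $\varphi_{n+1,n}(\pi_{1,n-1}(y,x))=\pi_{1,n}(y,\varphi_{n,n-1}(x))$. For $n\ge m$, $\varphi_{n,m}:X_m\to X_n$ is the composite $\varphi_{n,n-1}\circ\cdots\circ\varphi_{m+1,m}$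 ($\varphi_{n,n}=\mathrm{id}$). Define $\pi_{p,q}:Y^p\times X_q\to X_{p+q}$ by $\pi_{0,q}=\mathrm{id}$ and $\pi_{p,q}=\pi_{p-1,q+1}\circ(\mathrm{id}_{Y^{p-1}}\times\pi_{1,q})$ for $p\ge1$. Limit space. For $(y_1,\dots,y_p)\in Y^p$ the cell is $C(y_1,\dots,y_p)=\{\pi_{p,0}(y_1,\dots,y_p,x):x\in X_0\}\subset X_p$ (for $p=0$ it is $X_0$). $Y^{\mathbb N}$ is the space of sequences $(y_1,y_2,\dots)$ in $Y$ with the product topology. For $x_n\in X_n$, $\Gamma_n(x_n)=\{(y_1,y_2,\dots)\in Y^{\mathbb N}:\varphi_{p,n}(x_n)\in C(y_1,\dots,y_p)\ \forall p\ge n\}$. The relation $\mathcal R$ on $Y^{\mathbb N}$: $u\,\mathcal R\,v$ iff $u=v$ or there are $n\ge0$ and $x_n\in X_n$ with $u,v\in\Gamma_n(x_n)$. $\mathcal R_\infty$ is the smallest equivalence relation containing $\mathcal R$, and $X_\infty=Y^{\mathbb N}/\mathcal R_\infty$ carries the quotient topology.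
   Formalization: It is assumed in addition that X_0 is nonempty whenever Y is nonempty; if X_0 is empty and Y is not, every X_n is empty while X_∞ = Y^ℕ is nonempty, so the density claim (b) fails. *)

theory Defs
  imports "HOL-Analysis.Analysis"
begin

record ('a, 'b, 'y) scheme =
  space0 :: "'a topology"
  space1 :: "'b topology"
  labels :: "'y topology"
  emb :: "'a \<Rightarrow> 'b"
  proj :: "'y \<times> 'a \<Rightarrow> 'b"

definition similarity_scheme :: "('a, 'b, 'y) scheme \<Rightarrow> bool" where
  "similarity_scheme S \<longleftrightarrow>
     compact_space (space0 S) \<and> Hausdorff_space (space0 S) \<and>
     compact_space (space1 S) \<and> Hausdorff_space (space1 S) \<and>
     compact_space (labels S) \<and> Hausdorff_space (labels S) \<and>
     continuous_map (space0 S) (space1 S) (emb S) \<and> inj_on (emb S) (topspace (space0 S)) \<and>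
     continuous_map (prod_topology (labels S) (space0 S)) (space1 S) (proj S) \<and>
     proj S ` (topspace (labels S) \<times> topspace (space0 S)) = topspace (space1 S)"

text \<open>The topology coinduced by a function \<open>f\<close> on its image: this is the quotient topology for the
  identification made by \<open>f\<close>, and a homeomorphic copy of \<open>T\<close> if \<open>f\<close> is injective.\<close>

definition quotient_top :: "'p topology \<Rightarrow> ('p \<Rightarrow> 'q) \<Rightarrow> 'q topology" where
  "quotient_top T f =
     topology (\<lambda>U. U \<subseteq> f ` topspace T \<and> openin T {x \<in> topspace T. f x \<in> U})"

lemma openin_quotient_top:
  "openin (quotient_top T f) U \<longleftrightarrow> U \<subseteq> f ` topspace T \<and> openin T {x \<in> topspace T. f x \<in> U}"
proof -
  have "istopology (\<lambda>U. U \<subseteq> f ` topspace T \<and> openin T {x \<in> topspace T. f x \<in> U})"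
    unfolding istopology_def
  proof (intro conjI allI impI)
    fix U V
    assume "U \<subseteq> f ` topspace T \<and> openin T {x \<in> topspace T. f x \<in> U}"
      and "V \<subseteq> f ` topspace T \<and> openin T {x \<in> topspace T. f x \<in> V}"
    moreover have "{x \<in> topspace T. f x \<in> U \<inter> V} =
        {x \<in> topspace T. f x \<in> U} \<inter> {x \<in> topspace T. f x \<in> V}"
      by auto
    ultimately show "U \<inter> V \<subseteq> f ` topspace T" "openin T {x \<in> topspace T. f x \<in> U \<inter> V}"
      by auto
  next
    fix \<K>
    assume *: "\<forall>K\<in>\<K>. K \<subseteq> f ` topspace T \<and> openin T {x \<in> topspace T. f x \<in> K}"
    then show "\<Union>\<K> \<subseteq> f ` topspace T"
      by auto
    have "{x \<in> topspace T. f x \<in> \<Union>\<K>} = (\<Union>K\<in>\<K>. {x \<in> topspace T. f x \<in> K})"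
      by auto
    then show "openin T {x \<in> topspace T. f x \<in> \<Union>\<K>}"
      using * by auto
  qed
  then show ?thesis
    by (simp add: quotient_top_def)
qed

lemma topspace_quotient_top [simp]: "topspace (quotient_top T f) = f ` topspace T"
proof -
  have "{x \<in> topspace T. f x \<in> f ` topspace T} = topspace T"
    by auto
  then have "openin (quotient_top T f) (f ` topspace T)"
    by (simp add: openin_quotient_top)
  moreover have "topspace (quotient_top T f) \<subseteq> f ` topspace T"
    using openin_topspace[of "quotient_top T f"] unfolding openin_quotient_top by (rule conjunct1)
  ultimately show ?thesis
    by (intro subset_antisym openin_subset)
qed

lemma quotient_map_quotient_top: "quotient_map T (quotient_top T f) f"
  by (simp add: quotient_map_def openin_quotient_top)

text \<open>All spaces of the tower live on one type.  Points of the first two spaces are tagged copies of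
  the points of the given spaces; a point of a later space is \<open>Cls (y, z)\<close>, where \<open>(y, z)\<close> is a
  chosen representative of its equivalence class.\<close>

datatype ('a, 'b, 'y) point =
    Pt0 (un_Pt0: 'a)
  | Pt1 'b
  | Cls "'y \<times> ('a, 'b, 'y) point"

definition glued ::
  "('a, 'b, 'y) scheme \<Rightarrow> ('a \<Rightarrow> 'p) \<Rightarrow> 'y \<times> 'p \<Rightarrow> 'y \<times> 'p \<Rightarrow> bool" where
  "glued S f c c' \<longleftrightarrow> c = c' \<or>
     (\<exists>y\<in>topspace (labels S). \<exists>y'\<in>topspace (labels S).
      \<exists>x\<in>topspace (space0 S). \<exists>x'\<in>topspace (space0 S).
        c = (y, f x) \<and> c' = (y', f x') \<and> proj S (y, x) = proj S (y', x'))"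

text \<open>\<open>tower S n\<close> is \<open>X\<^sub>n\<close>, \<open>tower_pi S n\<close> is \<open>\<pi>\<^sub>1\<^sub>,\<^sub>n\<close> and \<open>tower_step S n\<close> is \<open>\<phi>\<^sub>n\<^sub>+\<^sub>1\<^sub>,\<^sub>n\<close>.  In the second
  equation for \<open>tower_pi\<close>, the \<open>fold\<close> is the composite \<open>\<phi>\<^sub>n\<^sub>+\<^sub>1\<^sub>,\<^sub>0\<close>.\<close>

function (sequential)
  tower :: "('a, 'b, 'y) scheme \<Rightarrow> nat \<Rightarrow> ('a, 'b, 'y) point topology" and
  tower_pi :: "('a, 'b, 'y) scheme \<Rightarrow> nat \<Rightarrow> 'y \<times> ('a, 'b, 'y) point \<Rightarrow> ('a, 'b, 'y) point" and
  tower_step :: "('a, 'b, 'y) scheme \<Rightarrow> nat \<Rightarrow> ('a, 'b, 'y) point \<Rightarrow> ('a, 'b, 'y) point"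
where
  "tower S 0 = quotient_top (space0 S) Pt0"
| "tower S (Suc 0) = quotient_top (space1 S) Pt1"
| "tower S (Suc (Suc n)) =
     quotient_top (prod_topology (labels S) (tower S (Suc n))) (tower_pi S (Suc n))"
| "tower_pi S 0 = (\<lambda>(y, z). Pt1 (proj S (y, un_Pt0 z)))"
| "tower_pi S (Suc n) =
     (\<lambda>c. Cls (SOME c'. glued S (\<lambda>x. fold (\<lambda>k. tower_step S k) [0..<Suc n] (Pt0 x)) c c'))"
| "tower_step S 0 = (\<lambda>z. Pt1 (emb S (un_Pt0 z)))"
| "tower_step S (Suc n) =
     (\<lambda>w. THE v. \<exists>y\<in>topspace (labels S). \<exists>z\<in>topspace (tower S n).
        w = tower_pi S n (y, z) \<and> v = tower_pi S (Suc n) (y, tower_step S n z))"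
  by pat_completeness auto

termination
  by (relation "Wellfounded.measure (\<lambda>s. case s of
        Inl (S, n) \<Rightarrow> 3 * n + 1
      | Inr (Inl (S, n)) \<Rightarrow> 3 * n
      | Inr (Inr (S, n)) \<Rightarrow> 3 * n + 2)") auto

text \<open>\<open>\<phi>\<^sub>n\<^sub>,\<^sub>m\<close>, for \<open>m \<le> n\<close>.\<close>

definition tower_emb ::
  "('a, 'b, 'y) scheme \<Rightarrow> nat \<Rightarrow> nat \<Rightarrow> ('a, 'b, 'y) point \<Rightarrow> ('a, 'b, 'y) point" where
  "tower_emb S n m = fold (\<lambda>k. tower_step S k) [m..<n]"

text \<open>\<open>\<pi>\<^sub>p\<^sub>,\<^sub>q\<close>, with \<open>(y\<^sub>1, \<dots>, y\<^sub>p)\<close> given as a list of length \<open>p\<close>.\<close>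

primrec tower_proj ::
  "('a, 'b, 'y) scheme \<Rightarrow> nat \<Rightarrow> nat \<Rightarrow> 'y list \<Rightarrow> ('a, 'b, 'y) point \<Rightarrow> ('a, 'b, 'y) point"
where
  "tower_proj S 0 q ys z = z"
| "tower_proj S (Suc p) q ys z =
     tower_proj S p (Suc q) (butlast ys) (tower_pi S q (last ys, z))"

definition cell :: "('a, 'b, 'y) scheme \<Rightarrow> 'y list \<Rightarrow> ('a, 'b, 'y) point set" where
  "cell S ys = tower_proj S (length ys) 0 ys ` topspace (tower S 0)"

text \<open>The sequence \<open>(y\<^sub>1, y\<^sub>2, \<dots>)\<close> is the function \<open>u\<close> with \<open>u i = y\<^sub>i\<^sub>+\<^sub>1\<close>.\<close>

definition seq_space :: "('a, 'b, 'y) scheme \<Rightarrow> (nat \<Rightarrow> 'y) topology" where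
  "seq_space S = product_topology (\<lambda>_. labels S) UNIV"

definition Gam :: "('a, 'b, 'y) scheme \<Rightarrow> nat \<Rightarrow> ('a, 'b, 'y) point \<Rightarrow> (nat \<Rightarrow> 'y) set" where
  "Gam S n x = {u \<in> topspace (seq_space S). \<forall>p\<ge>n. tower_emb S p n x \<in> cell S (map u [0..<p])}"

definition limit_rel :: "('a, 'b, 'y) scheme \<Rightarrow> (nat \<Rightarrow> 'y) rel" where
  "limit_rel S = {(u, v). u \<in> topspace (seq_space S) \<and> v \<in> topspace (seq_space S) \<and>
     (u = v \<or> (\<exists>n. \<exists>x\<in>topspace (tower S n). u \<in> Gam S n x \<and> v \<in> Gam S n x))}"

definition limit_equiv :: "('a, 'b, 'y) scheme \<Rightarrow> (nat \<Rightarrow> 'y) rel" where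
  "limit_equiv S = \<Inter>{r. equiv (topspace (seq_space S)) r \<and> limit_rel S \<subseteq> r}"

definition limit_space :: "('a, 'b, 'y) scheme \<Rightarrow> (nat \<Rightarrow> 'y) set topology" where
  "limit_space S = quotient_top (seq_space S) (\<lambda>u. limit_equiv S `` {u})"

lemma tower_emb_refl [simp]: "tower_emb S n n = id"
  by (simp add: tower_emb_def fun_eq_iff)

lemma tower_emb_Suc: "m \<le> n \<Longrightarrow> tower_emb S (Suc n) m x = tower_step S n (tower_emb S n m x)"
  by (simp add: tower_emb_def)

lemma tower_pi_Suc:
  "tower_pi S (Suc n) c = Cls (SOME c'. glued S (\<lambda>x. tower_emb S (Suc n) 0 (Pt0 x)) c c')"
  by (simp add: tower_emb_def)

lemma equivp_glued:
  assumes "inj_on f (topspace (space0 S))"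
  shows "equivp (glued S f)"
proof (rule equivpI)
  show "reflp (glued S f)"
    by (simp add: reflp_def glued_def)
  show "symp (glued S f)"
    unfolding symp_def
  proof (intro allI impI)
    fix a b assume "glued S f a b"
    then show "glued S f b a"
      unfolding glued_def by (elim disjE bexE conjE) (auto intro: sym)
  qed
  show "transp (glued S f)"
    unfolding transp_def
  proof (intro allI impI)
    fix a b c assume ab: "glued S f a b" and bc: "glued S f b c"
    show "glued S f a c"
    proof (cases "a = b \<or> b = c")
      case True
      then show ?thesis using ab bc by auto
    next
      case False
      obtain y y' x x' where 1: "y \<in> topspace (labels S)" "x \<in> topspace (space0 S)"
        "x' \<in> topspace (space0 S)" "a = (y, f x)" "b = (y', f x')" "proj S (y, x) = proj S (y', x')"
        using ab False unfolding glued_def by blast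
      obtain z z' w w' where 2: "z' \<in> topspace (labels S)" "w \<in> topspace (space0 S)"
        "w' \<in> topspace (space0 S)" "b = (z, f w)" "c = (z', f w')" "proj S (z, w) = proj S (z', w')"
        using bc False unfolding glued_def by blast
      have "z = y'" "w = x'"
        using 1 2 assms by (auto dest: inj_onD)
      then have "proj S (y, x) = proj S (z', w')"
        using 1 2 by simp
      then show ?thesis
        unfolding glued_def using 1 2 by blast
    qed
  qed
qed

lemma tower_pi_Suc_eq_iff:
  assumes "inj_on (\<lambda>x. tower_emb S (Suc n) 0 (Pt0 x)) (topspace (space0 S))"
  shows "tower_pi S (Suc n) c = tower_pi S (Suc n) c' \<longleftrightarrow>
         glued S (\<lambda>x. tower_emb S (Suc n) 0 (Pt0 x)) c c'"
proof -
  let ?R = "glued S (\<lambda>x. tower_emb S (Suc n) 0 (Pt0 x))"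
  have R: "equivp ?R"
    using assms by (rule equivp_glued)
  have *: "?R d (SOME e. ?R d e)" for d
    by (rule someI[of "?R d" d]) (use R in \<open>auto intro: equivp_reflp\<close>)
  have "(SOME e. ?R c e) = (SOME e. ?R c' e) \<longleftrightarrow> ?R c c'"
  proof
    assume "?R c c'"
    then have "?R c = ?R c'"
      using R unfolding equivp_def by blast
    then show "(SOME e. ?R c e) = (SOME e. ?R c' e)"
      by simp
  next
    assume "(SOME e. ?R c e) = (SOME e. ?R c' e)"
    then have "?R c (SOME e. ?R c' e)"
      using *[of c] by simp
    then show "?R c c'"
      using equivp_symp[OF R *[of c']] by (rule equivp_transp[OF R])
  qed
  then show ?thesis
    by (simp only: tower_pi_Suc point.inject)
qed

lemma quotient_map_tower_pi:
  "quotient_map (prod_topology (labels S) (tower S (Suc n))) (tower S (Suc (Suc n))) (tower_pi S (Suc n))"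
  by (simp only: tower.simps quotient_map_quotient_top)

lemma tower_pi_image:
  assumes "similarity_scheme S"
  shows "tower_pi S n ` (topspace (labels S) \<times> topspace (tower S n)) = topspace (tower S (Suc n))"
proof (cases n)
  case 0
  have "topspace (space1 S) = proj S ` (topspace (labels S) \<times> topspace (space0 S))"
    using assms by (simp add: similarity_scheme_def)
  then show ?thesis
    using 0 by (force simp: image_iff)
next
  case (Suc k)
  then show ?thesis
    using quotient_imp_surjective_map[OF quotient_map_tower_pi[of S k]] by simp
qed

lemma tower_spec:
  assumes S: "similarity_scheme S"
  shows "tower_step S n ` topspace (tower S n) \<subseteq> topspace (tower S (Suc n))"
    and "inj_on (tower_step S n) (topspace (tower S n))"
    and "inj_on (\<lambda>x. tower_emb S n 0 (Pt0 x)) (topspace (space0 S))"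
    and "(\<lambda>x. tower_emb S n 0 (Pt0 x)) ` topspace (space0 S) \<subseteq> topspace (tower S n)"
    and "\<lbrakk>y \<in> topspace (labels S); z \<in> topspace (tower S n)\<rbrakk> \<Longrightarrow>
      tower_step S (Suc n) (tower_pi S n (y, z)) = tower_pi S (Suc n) (y, tower_step S n z)"
proof -
  let ?Y = "topspace (labels S)"
  let ?e = "\<lambda>n x. tower_emb S n 0 (Pt0 x)"
  let ?I = "\<lambda>n. tower_step S n ` topspace (tower S n) \<subseteq> topspace (tower S (Suc n)) \<and>
    inj_on (tower_step S n) (topspace (tower S n)) \<and>
    inj_on (?e n) (topspace (space0 S)) \<and> ?e n ` topspace (space0 S) \<subseteq> topspace (tower S n) \<and>
    (\<forall>y\<in>?Y. \<forall>y'\<in>?Y. \<forall>z\<in>topspace (tower S n). \<forall>z'\<in>topspace (tower S n).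
       glued S (?e (Suc n)) (y, tower_step S n z) (y', tower_step S n z') \<longleftrightarrow>
       tower_pi S n (y, z) = tower_pi S n (y', z'))"
  have emb_Suc: "?e (Suc n) x = tower_step S n (?e n x)" for n x
    by (simp add: tower_emb_Suc)
  have G: "(glued S (?e (Suc n)) (y, tower_step S n z) (y', tower_step S n z') \<longleftrightarrow>
       glued S (?e n) (y, z) (y', z'))"
    if "inj_on (tower_step S n) (topspace (tower S n))"
      "?e n ` topspace (space0 S) \<subseteq> topspace (tower S n)"
      "z \<in> topspace (tower S n)" "z' \<in> topspace (tower S n)" for n y y' z z'
  proof -
    have i: "tower_step S n a = tower_step S n b \<longleftrightarrow> a = b"
      if "a \<in> topspace (tower S n)" "b \<in> topspace (tower S n)" for a b
      using that \<open>inj_on (tower_step S n) (topspace (tower S n))\<close> by (auto dest: inj_onD)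
    have "tower_step S n a = ?e (Suc n) x \<longleftrightarrow> a = ?e n x"
      if "a \<in> topspace (tower S n)" "x \<in> topspace (space0 S)" for a x
      unfolding emb_Suc
      using that \<open>?e n ` topspace (space0 S) \<subseteq> topspace (tower S n)\<close> by (intro i) auto
    then show ?thesis
      using that i unfolding glued_def by simp
  qed
  have inj_Suc: "inj_on (?e (Suc n)) (topspace (space0 S))" if "?I n" for n
  proof (rule inj_onI)
    fix x x' assume x: "x \<in> topspace (space0 S)" "x' \<in> topspace (space0 S)" and e: "?e (Suc n) x = ?e (Suc n) x'"
    have "?e n x \<in> topspace (tower S n)" "?e n x' \<in> topspace (tower S n)"
      using that x by auto
    moreover have "tower_step S n (?e n x) = tower_step S n (?e n x')"
      using e by (simp only: emb_Suc)
    ultimately have "?e n x = ?e n x'"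
      using that by (meson inj_onD)
    then show "x = x'"
      using that x by (meson inj_onD)
  qed
  have eq_Suc: "tower_step S (Suc n) (tower_pi S n (y, z)) = tower_pi S (Suc n) (y, tower_step S n z)"
    if I: "?I n" and "y \<in> ?Y" "z \<in> topspace (tower S n)" for n y z
  proof -
    have uniq: "v = tower_pi S (Suc n) (y, tower_step S n z)"
      if ex: "\<exists>y'\<in>?Y. \<exists>z'\<in>topspace (tower S n). tower_pi S n (y, z) = tower_pi S n (y', z') \<and>
          v = tower_pi S (Suc n) (y', tower_step S n z')" for v
    proof -
      obtain y' z' where *: "y' \<in> ?Y" "z' \<in> topspace (tower S n)"
        "tower_pi S n (y, z) = tower_pi S n (y', z')"
        "v = tower_pi S (Suc n) (y', tower_step S n z')"
        using ex by blast
      then have "glued S (?e (Suc n)) (y, tower_step S n z) (y', tower_step S n z')"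
        using I \<open>y \<in> ?Y\<close> \<open>z \<in> topspace (tower S n)\<close> by blast
      then show ?thesis
        using * by (simp only: tower_pi_Suc_eq_iff[OF inj_Suc[OF I], symmetric])
    qed
    show ?thesis
      unfolding tower_step.simps(2)
    proof (rule the_equality)
      show "\<exists>y'\<in>?Y. \<exists>z'\<in>topspace (tower S n). tower_pi S n (y, z) = tower_pi S n (y', z') \<and>
          tower_pi S (Suc n) (y, tower_step S n z) = tower_pi S (Suc n) (y', tower_step S n z')"
        by (intro bexI[of _ y] bexI[of _ z] conjI refl that)
    qed (rule uniq)
  qed
  have I: "?I n" for n
  proof (induction n)
    case 0
    have inj: "inj_on (emb S) (topspace (space0 S))" and im: "emb S ` topspace (space0 S) \<subseteq> topspace (space1 S)"
      using S by (auto simp: similarity_scheme_def continuous_map_def)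
    have b: "inj_on (tower_step S 0) (topspace (tower S 0))"
      using inj by (auto simp: inj_on_def)
    have d: "?e 0 ` topspace (space0 S) \<subseteq> topspace (tower S 0)"
      by simp
    have "glued S (?e (Suc 0)) (y, tower_step S 0 z) (y', tower_step S 0 z') \<longleftrightarrow>
       tower_pi S 0 (y, z) = tower_pi S 0 (y', z')"
      if "y \<in> ?Y" "y' \<in> ?Y" "z \<in> topspace (tower S 0)" "z' \<in> topspace (tower S 0)" for y y' z z'
      unfolding G[OF b d that(3,4)] using that by (auto simp: glued_def)
    then show ?case
      using b d im by (auto simp: inj_on_def)
  next
    case (Suc n)
    have inj: "inj_on (?e (Suc n)) (topspace (space0 S))"
      using inj_Suc Suc by blast
    have im: "?e (Suc n) ` topspace (space0 S) \<subseteq> topspace (tower S (Suc n))"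
      unfolding emb_Suc using Suc by blast
    have X: "topspace (tower S (Suc n)) = tower_pi S n ` (?Y \<times> topspace (tower S n))"
      using tower_pi_image[OF S] by simp
    have sub: "tower_step S (Suc n) ` topspace (tower S (Suc n)) \<subseteq> topspace (tower S (Suc (Suc n)))"
    proof -
      have "tower_step S (Suc n) (tower_pi S n (y, z)) \<in> topspace (tower S (Suc (Suc n)))"
        if "y \<in> ?Y" "z \<in> topspace (tower S n)" for y z
        unfolding eq_Suc[OF Suc that] tower_pi_image[OF S, of "Suc n", symmetric]
        using Suc that by blast
      then show ?thesis
        unfolding X by auto
    qed
    have b: "inj_on (tower_step S (Suc n)) (topspace (tower S (Suc n)))"
    proof (rule inj_onI)
      fix a a' assume a: "a \<in> topspace (tower S (Suc n))" "a' \<in> topspace (tower S (Suc n))"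
        and e: "tower_step S (Suc n) a = tower_step S (Suc n) a'"
      obtain y z where 1: "a = tower_pi S n (y, z)" "y \<in> ?Y" "z \<in> topspace (tower S n)"
        using a X by auto
      obtain y' z' where 2: "a' = tower_pi S n (y', z')" "y' \<in> ?Y" "z' \<in> topspace (tower S n)"
        using a X by auto
      have "tower_pi S (Suc n) (y, tower_step S n z) = tower_pi S (Suc n) (y', tower_step S n z')"
        using e unfolding 1(1) 2(1) eq_Suc[OF Suc 1(2,3)] eq_Suc[OF Suc 2(2,3)] .
      then have "glued S (?e (Suc n)) (y, tower_step S n z) (y', tower_step S n z')"
        by (simp only: tower_pi_Suc_eq_iff[OF inj])
      then show "a = a'"
        unfolding 1(1) 2(1) using Suc 1(2,3) 2(2,3) by blast
    qed
    have "\<forall>y\<in>?Y. \<forall>y'\<in>?Y. \<forall>z\<in>topspace (tower S (Suc n)). \<forall>z'\<in>topspace (tower S (Suc n)).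
       glued S (?e (Suc (Suc n))) (y, tower_step S (Suc n) z) (y', tower_step S (Suc n) z') \<longleftrightarrow>
       tower_pi S (Suc n) (y, z) = tower_pi S (Suc n) (y', z')"
      using G[OF b im] tower_pi_Suc_eq_iff[OF inj] by blast
    then show ?case
      using sub b inj im by blast
  qed
  show "tower_step S n ` topspace (tower S n) \<subseteq> topspace (tower S (Suc n))"
    and "inj_on (tower_step S n) (topspace (tower S n))"
    and "inj_on (\<lambda>x. tower_emb S n 0 (Pt0 x)) (topspace (space0 S))"
    and "(\<lambda>x. tower_emb S n 0 (Pt0 x)) ` topspace (space0 S) \<subseteq> topspace (tower S n)"
    using I[of n] by blast+
  show "tower_step S (Suc n) (tower_pi S n (y, z)) = tower_pi S (Suc n) (y, tower_step S n z)"
    if "y \<in> topspace (labels S)" "z \<in> topspace (tower S n)"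
    using eq_Suc[OF I] that by blast
qed

lemma tower_pi_eq_iff_glued:
  assumes "similarity_scheme S"
  shows "tower_pi S (Suc n) c = tower_pi S (Suc n) c' \<longleftrightarrow>
         glued S (\<lambda>x. tower_emb S (Suc n) 0 (Pt0 x)) c c'"
  using tower_pi_Suc_eq_iff tower_spec(3)[OF assms] by blast

end

theory Submission
  imports Defs
begin

text \<open>All sequences in \<open>\<Gamma>\<^sub>n(x)\<close> are identified in \<open>X\<^sub>\<infinity>\<close>, so \<open>\<phi>\<^sub>\<infinity>\<^sub>,\<^sub>n(x)\<close> is their common class; it
  is compatible with the tower because \<open>\<Gamma>\<^sub>m(x) \<subseteq> \<Gamma>\<^sub>n(\<phi>\<^sub>n\<^sub>,\<^sub>m(x))\<close>.  Non-emptiness of \<open>\<Gamma>\<^sub>0(x\<^sub>0)\<close> comes from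
  threads: sequences \<open>x\<^sub>0, x\<^sub>1, \<dots>\<close> in \<open>X\<^sub>0\<close> and \<open>y\<^sub>1, y\<^sub>2, \<dots>\<close> in \<open>Y\<close> with \<open>\<phi>(x\<^sub>i) = \<pi>(y\<^sub>i\<^sub>+\<^sub>1, x\<^sub>i\<^sub>+\<^sub>1)\<close>.
  Prepending a label \<open>y\<close> carries \<open>\<Gamma>\<^sub>n(z)\<close> into \<open>\<Gamma>\<^sub>n\<^sub>+\<^sub>1(\<pi>\<^sub>1\<^sub>,\<^sub>n(y, z))\<close> and therefore acts on \<open>X\<^sub>\<infinity>\<close>, with
  \<open>\<phi>\<^sub>\<infinity>\<^sub>,\<^sub>n\<^sub>+\<^sub>1(\<pi>\<^sub>1\<^sub>,\<^sub>n(y, z)) = y \<cdot> \<phi>\<^sub>\<infinity>\<^sub>,\<^sub>n(z)\<close>.  This yields density, since each finite word is a prefix of a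
  member of some \<open>\<Gamma>\<^sub>n(x)\<close>, and reduces continuity to \<open>n = 0\<close>, where it holds because the space of
  threads is compact and \<open>X\<^sub>0\<close> is Hausdorff.\<close>

declare tower.simps [simp del] tower_pi.simps [simp del] tower_step.simps [simp del]

subsection \<open>Prepending labels in the tower\<close>

lemma topspace_seq_space: "u \<in> topspace (seq_space S) \<longleftrightarrow> (\<forall>i. u i \<in> topspace (labels S))"
  by (auto simp: seq_space_def PiE_iff)

lemma topspace_tower_0: "topspace (tower S 0) = Pt0 ` topspace (space0 S)"
  by (simp add: tower.simps)

text \<open>\<open>tower_proj\<close> consumes its word from the last label, which acts first.
  Removing that label on both sides by induction leaves the first label as the outermost
  application, which makes cells recursive in the first label.\<close>

lemma tower_proj_Cons:
  "length ys = p \<Longrightarrow>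
     tower_proj S (Suc p) q (y # ys) z = tower_pi S (p + q) (y, tower_proj S p q ys z)"
proof (induction p arbitrary: q ys z)
  case 0
  then show ?case by simp
next
  case (Suc p)
  then have "ys \<noteq> []" "length (butlast ys) = p" by auto
  then have "tower_proj S (Suc (Suc p)) q (y # ys) z =
      tower_proj S (Suc p) (Suc q) (y # butlast ys) (tower_pi S q (last ys, z))"
    by simp
  also have "\<dots> = tower_pi S (p + Suc q)
      (y, tower_proj S p (Suc q) (butlast ys) (tower_pi S q (last ys, z)))"
    using Suc.IH[OF \<open>length (butlast ys) = p\<close>] .
  finally show ?case by simp
qed

lemma cell_Cons: "cell S (y # ys) = (\<lambda>w. tower_pi S (length ys) (y, w)) ` cell S ys"
  unfolding cell_def image_image length_Cons
  using tower_proj_Cons[OF refl, of S ys 0 y] by simp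

lemma tower_pi_in_tower:
  assumes "similarity_scheme S" "y \<in> topspace (labels S)" "z \<in> topspace (tower S n)"
  shows "tower_pi S n (y, z) \<in> topspace (tower S (Suc n))"
  using tower_pi_image[OF assms(1), of n] assms(2,3) by blast

lemma tower_emb_in_tower:
  assumes "similarity_scheme S" "n \<le> p" "z \<in> topspace (tower S n)"
  shows "tower_emb S p n z \<in> topspace (tower S p)"
  using assms(2)
proof (induction p rule: dec_induct)
  case base
  then show ?case using assms(3) by simp
next
  case (step p)
  then show ?case
    using tower_spec(1)[OF assms(1), of p] by (auto simp: tower_emb_Suc)
qed

lemma tower_emb_trans:
  assumes "m \<le> n" "n \<le> p"
  shows "tower_emb S p n (tower_emb S n m x) = tower_emb S p m x"
  using assms(2)
proof (induction p rule: dec_induct)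
  case (step p)
  then show ?case using assms(1) by (simp add: tower_emb_Suc)
qed simp

text \<open>Commuting \<open>tower_step\<close> with \<open>tower_pi\<close> is iterated from
  \<open>n\<close> to \<open>p\<close>; the indices on the left are one higher because
  \<open>tower_pi\<close> raises the level.\<close>

lemma tower_emb_tower_pi:
  assumes S: "similarity_scheme S" and "n \<le> p"
    and "y \<in> topspace (labels S)" "z \<in> topspace (tower S n)"
  shows "tower_emb S (Suc p) (Suc n) (tower_pi S n (y, z)) = tower_pi S p (y, tower_emb S p n z)"
  using assms(2)
proof (induction p rule: dec_induct)
  case (step p)
  then show ?case
    using tower_spec(5)[OF S assms(3) tower_emb_in_tower[OF S step(1) assms(4)]]
    by (simp add: tower_emb_Suc)
qed simp

lemma map_case_nat_upt: "map (case_nat y u) [0..<Suc p] = y # map u [0..<p]"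
  by (simp add: upt_conv_Cons map_Suc_upt[symmetric] del: upt_Suc)

text \<open>Applying \<open>tower_pi\<close> with label \<open>y\<close> commutes with the tower
  embeddings and carries the cell of a word to the cell of the word with \<open>y\<close> in front,
  so condition \<open>q\<close> on \<open>u\<close> becomes condition \<open>Suc q\<close> on
  \<open>case_nat y u\<close>.\<close>

lemma Gam_case_nat:
  assumes S: "similarity_scheme S" and y: "y \<in> topspace (labels S)"
    and z: "z \<in> topspace (tower S n)" and u: "u \<in> Gam S n z"
  shows "case_nat y u \<in> Gam S (Suc n) (tower_pi S n (y, z))"
proof -
  have "tower_emb S p (Suc n) (tower_pi S n (y, z)) \<in> cell S (map (case_nat y u) [0..<p])"
    if "Suc n \<le> p" for p
  proof -
    obtain q where q: "p = Suc q" "n \<le> q"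
      using \<open>Suc n \<le> p\<close> by (metis Suc_le_D Suc_le_mono)
    then have "tower_emb S q n z \<in> cell S (map u [0..<q])"
      using u by (simp add: Gam_def)
    then show ?thesis
      using tower_emb_tower_pi[OF S q(2) y z] unfolding q(1) map_case_nat_upt cell_Cons by simp
  qed
  moreover have "case_nat y u \<in> topspace (seq_space S)"
    using u y by (auto simp: Gam_def topspace_seq_space split: nat.split)
  ultimately show ?thesis
    by (simp add: Gam_def)
qed

text \<open>Used to push an embedding past all labels to the innermost point, where the equations of
  a thread apply. Each label costs one commutation of \<open>tower_step\<close> with
  \<open>tower_pi\<close>.\<close>

lemma tower_step_tower_proj:
  assumes S: "similarity_scheme S"
  shows "\<lbrakk>length ys = p; set ys \<subseteq> topspace (labels S); z \<in> topspace (tower S q)\<rbrakk> \<Longrightarrow>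
    tower_step S (p + q) (tower_proj S p q ys z) = tower_proj S p (Suc q) ys (tower_step S q z)"
proof (induction p arbitrary: q ys z)
  case (Suc p)
  then have "ys \<noteq> []" by auto
  then have l: "last ys \<in> topspace (labels S)"
    using Suc.prems(2) last_in_set by blast
  have b: "length (butlast ys) = p" "set (butlast ys) \<subseteq> topspace (labels S)"
    using Suc.prems by (auto dest: in_set_butlastD)
  have "tower_step S (p + Suc q) (tower_proj S p (Suc q) (butlast ys) (tower_pi S q (last ys, z))) =
      tower_proj S p (Suc (Suc q)) (butlast ys) (tower_step S (Suc q) (tower_pi S q (last ys, z)))"
    by (rule Suc.IH[OF b tower_pi_in_tower[OF S l Suc.prems(3)]])
  then show ?case
    using tower_spec(5)[OF S l Suc.prems(3)] by simp
qed simp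

subsection \<open>Threads\<close>

definition thread :: "('a, 'b, 'y) scheme \<Rightarrow> (nat \<Rightarrow> 'y) \<Rightarrow> (nat \<Rightarrow> 'a) \<Rightarrow> bool" where
  "thread S u xs \<longleftrightarrow> u \<in> topspace (seq_space S) \<and> (\<forall>i. xs i \<in> topspace (space0 S)) \<and>
     (\<forall>i. emb S (xs i) = proj S (u i, xs (Suc i)))"

lemma thread_tower_emb:
  assumes S: "similarity_scheme S" and t: "thread S u xs"
  shows "tower_emb S p 0 (Pt0 (xs 0)) = tower_proj S p 0 (map u [0..<p]) (Pt0 (xs p))"
proof (induction p)
  case (Suc p)
  have "tower_emb S (Suc p) 0 (Pt0 (xs 0)) =
      tower_step S (p + 0) (tower_proj S p 0 (map u [0..<p]) (Pt0 (xs p)))"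
    by (simp add: tower_emb_Suc Suc)
  also have "\<dots> = tower_proj S p (Suc 0) (map u [0..<p]) (tower_step S 0 (Pt0 (xs p)))"
    using t by (intro tower_step_tower_proj[OF S])
      (auto simp: thread_def topspace_seq_space topspace_tower_0)
  \<comment> \<open>The thread equation at \<open>p\<close> trades the embedding of
    \<open>xs p\<close> for the label \<open>u p\<close> and the next point; the word grows at its
    end.\<close>
  also have "tower_step S 0 (Pt0 (xs p)) = tower_pi S 0 (u p, Pt0 (xs (Suc p)))"
    using t by (simp add: thread_def tower_step.simps tower_pi.simps)
  finally show ?case by simp
qed simp

lemma thread_in_Gam:
  assumes S: "similarity_scheme S" and t: "thread S u xs"
  shows "u \<in> Gam S 0 (Pt0 (xs 0))"
  using t thread_tower_emb[OF S t]
  by (auto simp: Gam_def cell_def thread_def topspace_tower_0)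

lemma thread_exists:
  assumes S: "similarity_scheme S" and x: "x \<in> topspace (space0 S)"
  shows "\<exists>u xs. thread S u xs \<and> xs 0 = x"
proof -
  have "\<exists>y\<in>topspace (labels S). \<exists>x'\<in>topspace (space0 S). emb S x = proj S (y, x')"
    if "x \<in> topspace (space0 S)" for x
  proof -
    have "emb S x \<in> proj S ` (topspace (labels S) \<times> topspace (space0 S))"
      using S that by (auto simp: similarity_scheme_def continuous_map_def)
    then show ?thesis by auto
  qed
  \<comment> \<open>Surjectivity of \<open>proj S\<close> supplies a label \<open>f x\<close> and a
    next point \<open>g x\<close>; iterating \<open>g\<close> gives the thread.\<close>
  then obtain f g where fg: "f x \<in> topspace (labels S)" "g x \<in> topspace (space0 S)"
      "emb S x = proj S (f x, g x)" if "x \<in> topspace (space0 S)" for x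
    by metis
  define xs where "xs i = (g ^^ i) x" for i
  have xs: "xs i \<in> topspace (space0 S)" for i
    by (induction i) (auto simp: xs_def x fg)
  have "thread S (\<lambda>i. f (xs i)) xs"
    using fg[OF xs] by (auto simp: thread_def topspace_seq_space xs) (simp add: xs_def)
  moreover have "xs 0 = x"
    by (simp add: xs_def)
  ultimately show ?thesis
    by blast
qed

lemma Gam_nonempty:
  assumes S: "similarity_scheme S"
  shows "x \<in> topspace (tower S n) \<Longrightarrow> Gam S n x \<noteq> {}"
proof (induction n arbitrary: x)
  case 0
  then show ?case
    using thread_exists[OF S] thread_in_Gam[OF S] by (fastforce simp: topspace_tower_0)
next
  case (Suc n)
  then obtain y z where "x = tower_pi S n (y, z)" "y \<in> topspace (labels S)"
      "z \<in> topspace (tower S n)"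
    using tower_pi_image[OF S, of n] by force
  then show ?case
    using Suc.IH Gam_case_nat[OF S] by blast
qed

text \<open>Induction on the prefix length: the tail \<open>u \<circ> Suc\<close> is matched one
  level lower, then \<open>u 0\<close> is prepended.\<close>

lemma Gam_prefix:
  assumes S: "similarity_scheme S" and ne: "topspace (space0 S) \<noteq> {}"
  shows "u \<in> topspace (seq_space S) \<Longrightarrow>
    \<exists>x\<in>topspace (tower S n). \<exists>v\<in>Gam S n x. \<forall>i<n. v i = u i"
proof (induction n arbitrary: u)
  case 0
  obtain x where "x \<in> topspace (tower S 0)"
    using ne unfolding topspace_tower_0 by blast
  then show ?case
    using Gam_nonempty[OF S] by blast
next
  case (Suc n)
  have u: "u 0 \<in> topspace (labels S)" "u \<circ> Suc \<in> topspace (seq_space S)"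
    using Suc.prems by (auto simp: topspace_seq_space)
  obtain z v where z: "z \<in> topspace (tower S n)" "v \<in> Gam S n z" "\<forall>i<n. v i = u (Suc i)"
    using Suc.IH[OF u(2)] by auto
  have "\<forall>i<Suc n. case_nat (u 0) v i = u i"
    using z(3) by (auto split: nat.split)
  then show ?case
    using Gam_case_nat[OF S u(1) z(1,2)] tower_pi_in_tower[OF S u(1) z(1)] by blast
qed

subsection \<open>The limit space\<close>

lemma equiv_limit_equiv: "equiv (topspace (seq_space S)) (limit_equiv S)"
proof -
  let ?A = "topspace (seq_space S)"
  \<comment> \<open>The full relation belongs to the intersected family, so the intersection stays
    inside \<open>?A \<times> ?A\<close>.\<close>
  have "equiv ?A (?A \<times> ?A)" "limit_rel S \<subseteq> ?A \<times> ?A"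
    by (auto simp: equiv_def refl_on_def sym_def trans_def limit_rel_def)
  then have "limit_equiv S \<subseteq> ?A \<times> ?A"
    by (auto simp: limit_equiv_def)
  moreover have "refl_on ?A (limit_equiv S)"
    by (auto simp: limit_equiv_def refl_on_def equiv_def)
  moreover have "sym (limit_equiv S)"
    unfolding sym_def limit_equiv_def by (auto simp: equiv_def dest: symD)
  moreover have "trans (limit_equiv S)"
    unfolding trans_def limit_equiv_def equiv_def by (blast dest: transD)
  ultimately show ?thesis
    by (rule equivI)
qed

lemma limit_rel_subset: "limit_rel S \<subseteq> limit_equiv S"
  by (auto simp: limit_equiv_def)

text \<open>By minimality of \<open>limit_equiv\<close> it suffices that its pullback
  \<open>?r\<close> under prepending \<open>y\<close> is an equivalence relation containing
  \<open>limit_rel\<close>: a common point \<open>x\<close> at level \<open>n\<close> becomes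
  \<open>tower_pi S n (y, x)\<close> at level \<open>Suc n\<close>.\<close>

lemma limit_equiv_case_nat:
  assumes S: "similarity_scheme S" and y: "y \<in> topspace (labels S)"
    and uv: "(u, v) \<in> limit_equiv S"
  shows "(case_nat y u, case_nat y v) \<in> limit_equiv S"
proof -
  let ?A = "topspace (seq_space S)"
  let ?r = "{(u, v). u \<in> ?A \<and> v \<in> ?A \<and> (case_nat y u, case_nat y v) \<in> limit_equiv S}"
  have cn: "case_nat y w \<in> ?A" if "w \<in> ?A" for w
    using that y by (auto simp: topspace_seq_space split: nat.split)
  obtain r: "refl_on ?A (limit_equiv S)" and s: "sym (limit_equiv S)" and t: "trans (limit_equiv S)"
    by (rule equivE[OF equiv_limit_equiv])
  have "equiv ?A ?r"
  proof (rule equivI)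
    show "refl_on ?A ?r"
      using cn r by (auto simp: refl_on_def)
    show "sym ?r"
      using s by (auto simp: sym_def)
    show "trans ?r"
      using t unfolding trans_def by blast
  qed auto
  moreover have "limit_rel S \<subseteq> ?r"
  proof (clarsimp simp only: subset_iff mem_Collect_eq split_paired_all prod.case)
    fix u v assume uv: "(u, v) \<in> limit_rel S"
    then have A: "u \<in> ?A" "v \<in> ?A"
      by (auto simp: limit_rel_def)
    have "(case_nat y u, case_nat y v) \<in> limit_rel S"
      using uv cn[OF A(1)] cn[OF A(2)] Gam_case_nat[OF S y] tower_pi_in_tower[OF S y]
      unfolding limit_rel_def by blast
    then show "u \<in> ?A \<and> v \<in> ?A \<and> (case_nat y u, case_nat y v) \<in> limit_equiv S"
      using A limit_rel_subset by blast
  qed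
  ultimately have "limit_equiv S \<subseteq> ?r"
    unfolding limit_equiv_def by blast
  then show ?thesis
    using uv by blast
qed

lemma quotient_map_limit:
  "quotient_map (seq_space S) (limit_space S) (\<lambda>u. limit_equiv S `` {u})"
  unfolding limit_space_def by (rule quotient_map_quotient_top)

text \<open>Saturating the image of the class avoids the choice of a representative.\<close>

definition limit_shift :: "('a, 'b, 'y) scheme \<Rightarrow> 'y \<Rightarrow> (nat \<Rightarrow> 'y) set \<Rightarrow> (nat \<Rightarrow> 'y) set" where
  "limit_shift S y c = limit_equiv S `` (case_nat y ` c)"

lemma limit_shift_class:
  assumes S: "similarity_scheme S" and y: "y \<in> topspace (labels S)"
    and u: "u \<in> topspace (seq_space S)"
  shows "limit_shift S y (limit_equiv S `` {u}) = limit_equiv S `` {case_nat y u}"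
proof -
  have "(u, u) \<in> limit_equiv S"
    using equiv_limit_equiv[of S] u by (auto simp: equiv_def refl_on_def)
  moreover have "limit_equiv S `` {case_nat y v} = limit_equiv S `` {case_nat y u}"
    if "(u, v) \<in> limit_equiv S" for v
    using equiv_class_eq[OF equiv_limit_equiv limit_equiv_case_nat[OF S y that]] by simp
  ultimately show ?thesis
    unfolding limit_shift_def by blast
qed

lemma continuous_map_limit_shift:
  assumes S: "similarity_scheme S"
  shows "continuous_map (prod_topology (labels S) (limit_space S)) (limit_space S)
    (\<lambda>(y, c). limit_shift S y c)"
proof (rule continuous_compose_quotient_map)
  let ?q = "\<lambda>u. limit_equiv S `` {u}"
  \<comment> \<open>The identity of Y times a quotient map is again a quotient map because Y is
    compact Hausdorff, hence locally compact; this gives joint continuity in label and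
    class.\<close>
  show "quotient_map (prod_topology (labels S) (seq_space S))
      (prod_topology (labels S) (limit_space S)) (\<lambda>(y, u). (y, ?q u))"
    using S by (intro quotient_map_prod_right quotient_map_limit)
      (auto simp: similarity_scheme_def compact_imp_locally_compact_space)
  have "continuous_map (prod_topology (labels S) (seq_space S)) (labels S)
      (\<lambda>c. case_nat (fst c) (snd c) i)" for i
  proof (cases i)
    case 0
    then show ?thesis by (simp add: continuous_map_fst)
  next
    case (Suc j)
    have "continuous_map (seq_space S) (labels S) (\<lambda>u. u j)"
      unfolding seq_space_def by (rule continuous_map_product_projection) simp
    then show ?thesis
      using Suc continuous_map_compose[OF continuous_map_snd] by (fastforce simp: o_def)
  qed
  then have "continuous_map (prod_topology (labels S) (seq_space S)) (seq_space S)
      (\<lambda>c. case_nat (fst c) (snd c))"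
    unfolding seq_space_def continuous_map_componentwise_UNIV by blast
  then have "continuous_map (prod_topology (labels S) (seq_space S)) (limit_space S)
      (?q \<circ> (\<lambda>c. case_nat (fst c) (snd c)))"
    using quotient_imp_continuous_map[OF quotient_map_limit] by (rule continuous_map_compose)
  then show "continuous_map (prod_topology (labels S) (seq_space S)) (limit_space S)
      ((\<lambda>(y, c). limit_shift S y c) \<circ> (\<lambda>(y, u). (y, ?q u)))"
    by (rule continuous_map_eq) (auto simp: limit_shift_class[OF S])
qed

subsection \<open>The maps into the limit space\<close>

definition limit_emb ::
  "('a, 'b, 'y) scheme \<Rightarrow> nat \<Rightarrow> ('a, 'b, 'y) point \<Rightarrow> (nat \<Rightarrow> 'y) set" where
  "limit_emb S n x = limit_equiv S `` Gam S n x"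

lemma limit_emb_eq:
  assumes x: "x \<in> topspace (tower S n)" and u: "u \<in> Gam S n x"
  shows "limit_emb S n x = limit_equiv S `` {u}"
proof -
  have "limit_equiv S `` {v} = limit_equiv S `` {u}" if "v \<in> Gam S n x" for v
  proof (rule equiv_class_eq[OF equiv_limit_equiv])
    have "u \<in> topspace (seq_space S)" "v \<in> topspace (seq_space S)"
      using u that by (auto simp: Gam_def)
    then show "(v, u) \<in> limit_equiv S"
      using x u that limit_rel_subset[of S] unfolding limit_rel_def by blast
  qed
  then show ?thesis
    using u unfolding limit_emb_def by blast
qed

lemma limit_emb_tower_emb:
  assumes S: "similarity_scheme S" and "m \<le> n" and x: "x \<in> topspace (tower S m)"
  shows "limit_emb S n (tower_emb S n m x) = limit_emb S m x"
proof -
  obtain u where u: "u \<in> Gam S m x"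
    using Gam_nonempty[OF S x] by blast
  \<comment> \<open>The conditions for \<open>p \<ge> n\<close> are among those for
    \<open>p \<ge> m\<close>.\<close>
  then have "u \<in> Gam S n (tower_emb S n m x)"
    using \<open>m \<le> n\<close> by (simp add: Gam_def tower_emb_trans)
  then show ?thesis
    using limit_emb_eq u x tower_emb_in_tower[OF S \<open>m \<le> n\<close> x] by metis
qed

lemma limit_emb_tower_pi:
  assumes S: "similarity_scheme S" and y: "y \<in> topspace (labels S)"
    and z: "z \<in> topspace (tower S n)"
  shows "limit_emb S (Suc n) (tower_pi S n (y, z)) = limit_shift S y (limit_emb S n z)"
proof -
  obtain u where u: "u \<in> Gam S n z"
    using Gam_nonempty[OF S z] by blast
  then have "u \<in> topspace (seq_space S)"
    by (simp add: Gam_def)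
  then show ?thesis
    using limit_emb_eq[OF z u] limit_shift_class[OF S y]
      limit_emb_eq[OF tower_pi_in_tower[OF S y z] Gam_case_nat[OF S y z u]] by simp
qed

section \<open>Continuity of the maps into the limit space\<close>

lemma closedin_thread:
  assumes S: "similarity_scheme S"
  shows "closedin (prod_topology (seq_space S) (product_topology (\<lambda>_. space0 S) UNIV))
    {(u, xs). thread S u xs}"
proof -
  let ?T = "prod_topology (seq_space S) (product_topology (\<lambda>_::nat. space0 S) UNIV)"
  have u: "continuous_map ?T (labels S) (\<lambda>c. fst c i)" for i
    using continuous_map_compose[OF continuous_map_fst
        continuous_map_product_projection[of i UNIV "\<lambda>_. labels S"]]
    unfolding seq_space_def by (fastforce simp: o_def)
  have x: "continuous_map ?T (space0 S) (\<lambda>c. snd c i)" for i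
    using continuous_map_compose[OF continuous_map_snd
        continuous_map_product_projection[of i UNIV "\<lambda>_. space0 S"]]
    by (fastforce simp: o_def)
  \<comment> \<open>Each thread equation equates two continuous maps into the Hausdorff space X_1,
    so its solution set is closed; the threads are the intersection over all
    \<open>i\<close>.\<close>
  have "closedin ?T {c \<in> topspace ?T. emb S (snd c i) = proj S (fst c i, snd c (Suc i))}" for i
  proof (rule closedin_continuous_maps_eq)
    show "Hausdorff_space (space1 S)"
      using S by (simp add: similarity_scheme_def)
    have "continuous_map (space0 S) (space1 S) (emb S)"
      using S by (simp add: similarity_scheme_def)
    then show "continuous_map ?T (space1 S) (\<lambda>c. emb S (snd c i))"
      using continuous_map_compose[OF x[of i]] by (fastforce simp: o_def)
    have "continuous_map (prod_topology (labels S) (space0 S)) (space1 S) (proj S)"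
      using S by (simp add: similarity_scheme_def)
    moreover have "continuous_map ?T (prod_topology (labels S) (space0 S))
        (\<lambda>c. (fst c i, snd c (Suc i)))"
      using u x by (simp add: continuous_map_pairwise o_def)
    ultimately show "continuous_map ?T (space1 S) (\<lambda>c. proj S (fst c i, snd c (Suc i)))"
      by (rule continuous_map_compose[unfolded o_def, rotated])
  qed
  then have "closedin ?T
      (\<Inter>i. {c \<in> topspace ?T. emb S (snd c i) = proj S (fst c i, snd c (Suc i))})"
    by blast
  moreover have "{(u, xs). thread S u xs} =
      (\<Inter>i. {c \<in> topspace ?T. emb S (snd c i) = proj S (fst c i, snd c (Suc i))})"
    by (auto simp: thread_def PiE_iff)
  ultimately show ?thesis
    by simp
qed

text \<open>The preimage of a closed \<open>C\<close> is the image, under the starting point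
  \<open>xs 0\<close>, of the compact set \<open>?K\<close> of threads whose label sequence has its
  class in \<open>C\<close>; in the Hausdorff space X_0 this image is closed.\<close>

lemma continuous_map_limit_emb_0:
  assumes S: "similarity_scheme S"
  shows "continuous_map (tower S 0) (limit_space S) (limit_emb S 0)"
  unfolding tower.simps
proof (rule continuous_compose_quotient_map[OF quotient_map_quotient_top])
  let ?q = "\<lambda>u. limit_equiv S `` {u}"
  let ?T = "prod_topology (seq_space S) (product_topology (\<lambda>_::nat. space0 S) UNIV)"
  have emb_thread: "limit_emb S 0 (Pt0 (xs 0)) = ?q u" if "thread S u xs" for u xs
    using that thread_in_Gam[OF S that]
    by (intro limit_emb_eq) (auto simp: thread_def topspace_tower_0)
  have q: "continuous_map (seq_space S) (limit_space S) ?q"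
    by (rule quotient_imp_continuous_map[OF quotient_map_limit])
  have T: "compact_space ?T"
    using S by (simp add: similarity_scheme_def seq_space_def compact_space_prod_topology
        compact_space_product_topology)
  have "continuous_map ?T (product_topology (\<lambda>_::nat. space0 S) UNIV) snd"
    by (rule continuous_map_snd)
  then have c0: "continuous_map ?T (space0 S) (\<lambda>c. snd c 0)"
    unfolding continuous_map_componentwise_UNIV by blast
  have F: "continuous_map ?T (limit_space S) (\<lambda>c. ?q (fst c))"
    using continuous_map_compose[OF continuous_map_fst q] by (fastforce simp: o_def)
  show "continuous_map (space0 S) (limit_space S) (limit_emb S 0 \<circ> Pt0)"
    unfolding continuous_map_closedin
  proof (intro conjI allI impI)
    show "limit_emb S 0 \<circ> Pt0 \<in> topspace (space0 S) \<rightarrow> topspace (limit_space S)"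
    proof
      fix x assume "x \<in> topspace (space0 S)"
      then obtain u xs where t: "thread S u xs" "xs 0 = x"
        using thread_exists[OF S] by blast
      moreover have "?q u \<in> topspace (limit_space S)"
        using t by (simp add: limit_space_def thread_def)
      ultimately show "(limit_emb S 0 \<circ> Pt0) x \<in> topspace (limit_space S)"
        using emb_thread by fastforce
    qed
  next
    fix C assume C: "closedin (limit_space S) C"
    let ?K = "{(u, xs). thread S u xs} \<inter> {c \<in> topspace ?T. ?q (fst c) \<in> C}"
    have "closedin ?T ?K"
      using closedin_continuous_map_preimage[OF F C] closedin_thread[OF S] by blast
    then have "compactin (space0 S) ((\<lambda>c. snd c 0) ` ?K)"
      using T c0 by (blast intro: image_compactin closedin_compact_space)
    then have "closedin (space0 S) ((\<lambda>c. snd c 0) ` ?K)"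
      using S by (simp add: compactin_imp_closedin similarity_scheme_def)
    moreover have "(\<lambda>c. snd c 0) ` ?K = {x \<in> topspace (space0 S). (limit_emb S 0 \<circ> Pt0) x \<in> C}"
    proof (intro subset_antisym subsetI)
      fix x assume "x \<in> (\<lambda>c. snd c 0) ` ?K"
      then obtain u xs where "thread S u xs" "?q u \<in> C" "x = xs 0"
        by auto
      then show "x \<in> {x \<in> topspace (space0 S). (limit_emb S 0 \<circ> Pt0) x \<in> C}"
        using emb_thread[of u xs] by (simp add: thread_def)
    next
      fix x assume x: "x \<in> {x \<in> topspace (space0 S). (limit_emb S 0 \<circ> Pt0) x \<in> C}"
      \<comment> \<open>Any thread starting at \<open>x\<close> serves, since
        \<open>emb_thread\<close> holds for each of them.\<close>
      then obtain u xs where t: "thread S u xs" "xs 0 = x"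
        using thread_exists[OF S] by blast
      then have "(u, xs) \<in> ?K"
        using x emb_thread[OF t(1)] by (auto simp: thread_def)
      then show "x \<in> (\<lambda>c. snd c 0) ` ?K"
        using t(2) by force
    qed
    ultimately show "closedin (space0 S) {x \<in> topspace (space0 S). (limit_emb S 0 \<circ> Pt0) x \<in> C}"
      by simp
  qed
qed

text \<open>For positive \<open>n\<close> this is the construction. For \<open>n = 0\<close>,
  \<open>proj S\<close> is a quotient map as a continuous surjection from a compact onto a Hausdorff
  space, and the tags \<open>Pt0\<close> and \<open>Pt1\<close> have to be carried along.\<close>

lemma quotient_map_tower_pi_all:
  assumes S: "similarity_scheme S"
  shows "quotient_map (prod_topology (labels S) (tower S n)) (tower S (Suc n)) (tower_pi S n)"
proof (cases n)
  case 0
  have Pt0: "quotient_map (space0 S) (tower S 0) Pt0"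
    and Pt1: "quotient_map (space1 S) (tower S (Suc 0)) Pt1"
    by (simp_all add: tower.simps quotient_map_quotient_top)
  have proj: "quotient_map (prod_topology (labels S) (space0 S)) (space1 S) (proj S)"
    using S by (intro continuous_imp_quotient_map)
      (auto simp: similarity_scheme_def compact_space_prod_topology)
  have comp: "quotient_map (prod_topology (labels S) (space0 S)) (tower S (Suc 0))
      (tower_pi S 0 \<circ> (\<lambda>(y, x). (y, Pt0 x)))"
    using quotient_map_compose[OF proj Pt1]
    by (rule quotient_map_eq) (auto simp: tower_pi.simps)
  have q: "quotient_map (prod_topology (labels S) (space0 S)) (prod_topology (labels S) (tower S 0))
      (\<lambda>(y, x). (y, Pt0 x))"
    using S by (intro quotient_map_prod_right Pt0)
      (auto simp: similarity_scheme_def compact_imp_locally_compact_space)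
  show ?thesis
    unfolding 0
    by (rule quotient_map_from_composition[OF quotient_imp_continuous_map[OF q] _ comp])
      (rule continuous_compose_quotient_map[OF q quotient_imp_continuous_map[OF comp]])
next
  case (Suc k)
  then show ?thesis
    using quotient_map_tower_pi by blast
qed

text \<open>Composed with the quotient map \<open>tower_pi S n\<close>, the map at level
  \<open>Suc n\<close> becomes \<open>limit_shift\<close> applied to the label and
  \<open>limit_emb S n\<close>.\<close>

lemma continuous_map_limit_emb:
  assumes S: "similarity_scheme S"
  shows "continuous_map (tower S n) (limit_space S) (limit_emb S n)"
proof (induction n)
  case 0
  show ?case by (rule continuous_map_limit_emb_0[OF S])
next
  case (Suc n)
  show ?case
  proof (rule continuous_compose_quotient_map[OF quotient_map_tower_pi_all[OF S]])
    have "continuous_map (prod_topology (labels S) (tower S n))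
        (prod_topology (labels S) (limit_space S)) (\<lambda>(y, z). (y, limit_emb S n z))"
      using Suc by (simp add: continuous_map_prod_top[of _ _ _ _ "\<lambda>y. y", simplified])
    from continuous_map_compose[OF this continuous_map_limit_shift[OF S]]
    show "continuous_map (prod_topology (labels S) (tower S n)) (limit_space S)
        (limit_emb S (Suc n) \<circ> tower_pi S n)"
      by (rule continuous_map_eq) (auto simp: limit_emb_tower_pi[OF S])
  qed
qed

section \<open>Density of the union of the images\<close>

lemma limit_emb_dense:
  assumes S: "similarity_scheme S" and ne: "topspace (labels S) \<noteq> {} \<longrightarrow> topspace (space0 S) \<noteq> {}"
  shows "limit_space S closure_of (\<Union>n. limit_emb S n ` topspace (tower S n)) =
    topspace (limit_space S)"
  unfolding dense_intersects_open
proof (intro allI impI)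
  fix U assume U: "openin (limit_space S) U \<and> U \<noteq> {}"
  define W where "W = {u \<in> topspace (seq_space S). limit_equiv S `` {u} \<in> U}"
  have W: "openin (seq_space S) W"
    using U by (simp add: limit_space_def openin_quotient_top W_def)
  obtain u where u: "u \<in> W"
    using U by (auto simp: limit_space_def openin_quotient_top W_def)
  then have us: "u \<in> topspace (seq_space S)"
    by (simp add: W_def)
  \<comment> \<open>The sequence \<open>u\<close> shows that Y is non-empty. If X_0 were empty as
    well, all X_n would be empty and density would fail; \<open>ne\<close> excludes this.\<close>
  then have "topspace (space0 S) \<noteq> {}"
    using ne by (auto simp: topspace_seq_space)
  obtain V where V: "finite {i. V i \<noteq> topspace (labels S)}" "u \<in> Pi\<^sub>E UNIV V" "Pi\<^sub>E UNIV V \<subseteq> W"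
    using W u unfolding seq_space_def openin_product_topology_alt by fastforce
  \<comment> \<open>Only coordinates below \<open>n\<close> are restricted by \<open>V\<close>, so
    every sequence in Y sharing the first \<open>n\<close> labels of \<open>u\<close> lies in
    \<open>W\<close>.\<close>
  obtain n where n: "\<forall>i\<in>{i. V i \<noteq> topspace (labels S)}. i < n"
    using V(1) finite_nat_set_iff_bounded by blast
  obtain x v where x: "x \<in> topspace (tower S n)" and v: "v \<in> Gam S n x" "\<forall>i<n. v i = u i"
    using Gam_prefix[OF S \<open>topspace (space0 S) \<noteq> {}\<close> us] by blast
  have "v i \<in> V i" for i
  proof (cases "i < n")
    case True
    then show ?thesis using v(2) V(2) by (simp add: PiE_iff)
  next
    case False
    then have "V i = topspace (labels S)" using n by blast
    then show ?thesis using v(1) by (simp add: Gam_def topspace_seq_space)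
  qed
  then have "v \<in> W"
    using V(3) by (auto simp: PiE_iff)
  then have "limit_emb S n x \<in> U"
    using limit_emb_eq[OF x v(1)] by (simp add: W_def)
  then show "(\<Union>n. limit_emb S n ` topspace (tower S n)) \<inter> U \<noteq> {}"
    using x by blast
qed

theorem theorem3p6:
  fixes S :: "('a, 'b, 'y) scheme"
  assumes "similarity_scheme S"
    and "topspace (labels S) \<noteq> {} \<longrightarrow> topspace (space0 S) \<noteq> {}"
  shows "\<exists>\<Phi> :: nat \<Rightarrow> ('a, 'b, 'y) point \<Rightarrow> (nat \<Rightarrow> 'y) set.
    (\<forall>n. continuous_map (tower S n) (limit_space S) (\<Phi> n)) \<and>
    (\<forall>m n. m \<le> n \<longrightarrow> (\<forall>x\<in>topspace (tower S m). \<Phi> n (tower_emb S n m x) = \<Phi> m x)) \<and>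
    limit_space S closure_of (\<Union>n. \<Phi> n ` topspace (tower S n)) = topspace (limit_space S)"
  using continuous_map_limit_emb[OF assms(1)] limit_emb_tower_emb[OF assms(1)]
    limit_emb_dense[OF assms]
  by (intro exI[of _ "limit_emb S"]) blast

end
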